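(* Suppose that $\mu$ is the operating mode of the system at time $t$, which is the beginning of an interval. Let $(x(t),v(t-1))\in\mathrm{Proj}_{(x,v_0)}\tilde O_{\infty,\mu}$, and $\|v(t-1)-r\|\le\vartheta$, where $\vartheta\in\mathbb{R}_{\ge0}$. Consider the optimization problem $$\min_{v_0,\dots,v_{T_d-1}}\ \Omega\sum_{i=0}^{T_d-1}\|v_i-r\|_R^2+(1-\Omega)\hat J_d(v_0,\dots,v_{T_d-1})$$ subject to $\|v_i-r\|\le\vartheta$ for all $i\in\{0,\dots,T_d-1\}$, $(x(t),v_0,\dots,v_{T_d-1})\in\tilde O_{\infty,\mu}$, and $$\hat x(T_d|t,\bar\mu,K_\mu,G_\mu)\in\mathcal R_{\bar\mu}^{T_r},\qquad \hat z_1(k|t,\bar\mu,K_\mu,G_\mu)\in\mathcal Z_1^+,\qquad \hat z_2(k|t,\bar\mu,K_\mu,G_\mu)\in\mathcal Z_2^+\sim\mathcal P_\beta(k)$$ for $k\in\{0,1,\dots,T_d\}$ and all $\bar\mu\in\mathcal M_\mu^+$, where $R=R^\top>0$ is a design matrix and $\Omega\in[0,1]$ is a design parameter. Then the auxiliary reference (AR) sequence $v(t+i)=v_i^\ast$, $i\in\{0,\dots,T_d-1\}$, where $v_i^\ast$ is the optimal solution, results in the relaxed constraints being satisfied within the interval $[t,t+T_d-1]$. If the operating mode of the system remains constant over $[t,t+T_d-1]$, the computed AR sequence results in the constraints $\mathbb{E}[z_1(\cdot|\mu)]\in\mathcal Z_1$, $\mathbb{P}(z_2(\cdot|\mu)\in\mathcal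 Z_2)\ge\beta$ being satisfied within that interval.
   Context: Multi-mode system: for each mode $\mu$ in a finite set $\mathcal M$, $x(t+1|\mu)=A_{o,\mu}x(t|\mu)+B_{o,\mu}u(t|\mu)+\omega_\mu(t)$, $y(t|\mu)=Cx(t|\mu)+\xi(t)\in\mathbb{R}^m$, $x\in\mathbb{R}^n$, $u\in\mathbb{R}^p$; $\omega_\mu,\xi$ are mutually independent zero-mean Gaussian processes with covariances $H_{\omega_\mu},H_\xi$. The control law for mode $\mu$ is $u=K_\mu x+G_\mu v$ with AR $v(t)\in\mathbb{R}^m$; $A_\mu=A_{o,\mu}+B_{o,\mu}K_\mu$ is strictly Schur for every $\mu$, $B_\mu=B_{o,\mu}G_\mu$. Constrained outputs: $z_1(t|\mu)=L_xx(t|\mu)+L_vv(t)+\zeta(t)\in\mathbb{R}^{n_e}$, $z_2(t|\mu)=F_xx(t|\mu)+F_vv(t)+\varsigma(t)\in\mathbb{R}^{n_c}$, $\zeta(t)\sim\mathcal N(0,H_\zeta)$, $\varsigma(t)\sim\mathcal N(0,H_\varsigma)$. Nominal constraints: $\mathbb{E}[z_1(t|\mu)]\in\mathcal Z_1$, $\mathbb{P}(z_2(t|\mu)\in\mathcal Z_2)\ge\beta$, with $\mathcal Z_1,\mathcal Z_2$ compact, convex, containing the origin. The pairs $(L_x,A_\mu)$, $(F_x,A_\mu)$ are observable for all $\mu$. $r\in\mathbb{R}^m$ is the desired reference; $\|v\|$ is the Euclidean norm and $\|v\|_R^2=v^\top Rv$. $\mathcal M_\mu^+$ is the set of successor modes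 of $\mu$; until a mode change is detected the gains $K_\mu,G_\mu$ remain in use. Standing assumptions: (i) the time between subsequent faults is large, so only one mode change needs to be considered at a time; (ii) constraints can be temporarily relaxed to the relaxed constraints $\mathbb{E}[z_1]\in\mathcal Z_1^+$, $\mathbb{P}(z_2\in\mathcal Z_2^+)\ge\beta$, with extended sets $\mathcal Z_1^+\supset\mathcal Z_1$, $\mathcal Z_2^+\supset\mathcal Z_2$, for at most $T_e\in\mathbb{Z}_{\ge2}$ steps. $T_d$ is the detection time (length of detection interval), $T_r$ the recovery time, $0<T_r<T_e-2T_d$. Notation: $X\oplus Y$ is the Minkowski sum (points identified with singletons), $X\sim Y=\{x:x+y\in X\ \forall y\in Y\}$ the Pontryagin difference, $\mathcal B_\epsilon$ the open ball of fixed radius $\epsilon>0$ about the origin, $\mathrm{Proj}_{(x,v_0)}$ projection onto the $(x,v_0)$ coordinates. Predictions: for a pair of matrices $(A,B)$, noise-free $\hat x(k+1|t)=A\hat x(k|t)+Bv(t+k)$, $\hat x(0|t)=x(t)$, $\hat z_1(k|t)=L_x\hat x(k|t)+L_vv(t+k)$, $\hat z_2(k|t)=F_x\hat x(k|t)+F_vv(t+k)$; noise-driven $\tilde x(k+1|t)=A\tilde x(k|t)+\omega(t+k)$, $\tilde x(0|t)=0$, $\tilde z_2(k|t)=F_x\tilde x(k|t)+\varsigma(t+k)$; $\mathcal P_\beta(k)$ is the confidence ellipsoid of level $\beta$, $\mathbb{P}(\tilde z_2(k|t)\in\mathcal P_\beta(k))=\beta$, for the system under consideration. The arguments $(\cdot|t,\mu)$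 mean $(A,B)=(A_\mu,B_\mu)$; $(\cdot|t,\bar\mu,K_\mu,G_\mu)$ mean $(A,B)=(A_{o,\bar\mu}+B_{o,\bar\mu}K_\mu,\ B_{o,\bar\mu}G_\mu)$, i.e. the gains for $\mu$ applied to system $\bar\mu$, with $v(t+k)=v_k$ for $k\le T_d-1$ and, at $k=T_d$, the last value $v_{T_d-1}$ held. Set $\tilde O_{\infty,\mu}$: with $T=T_d-1$, for $x\in\mathbb{R}^n$, $v_0,\dots,v_T\in\mathbb{R}^m$, let $\hat x_T$ be the noise-free prediction (mode $\mu$) at step $T$ from $x$ under $v_0,\dots,v_{T-1}$, and for $k\ge0$ let $\hat z_1(k|x,v_0,\dots,v_T)=L_xA_\mu^k(\hat x_T-(I_n-A_\mu)^{-1}B_\mu v_T)+(L_x(I_n-A_\mu)^{-1}B_\mu+L_v)v_T$, $\hat z_2(k|x,v_0,\dots,v_T)=F_xA_\mu^k(\hat x_T-(I_n-A_\mu)^{-1}B_\mu v_T)+(F_x(I_n-A_\mu)^{-1}B_\mu+F_v)v_T$. Let $\Phi_k$ be the set of $(x,v_0,\dots,v_T)$ with $\hat z_1(k|x,v_0,\dots,v_T)\in\mathcal Z_1$, $\hat z_2(k|x,v_0,\dots,v_T)\in\mathcal Z_2\sim\mathcal P_\beta(k)$; let $\bar\Phi$ be the set of $(x,v_0,\dots,v_T)$ such that the noise-free predicted outputs from $x$ under $v_0,\dots,v_T$ lie in $\mathcal Z_1$ and $\mathcal Z_2\sim\mathcal P_\beta(k)$, respectively, for $k=0,\dots,T$,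 and $(L_x(I_n-A_\mu)^{-1}B_\mu+L_v)v_T\oplus\mathcal B_\epsilon\subset\mathcal Z_1$, $(F_x(I_n-A_\mu)^{-1}B_\mu+F_v)v_T\oplus\mathcal B_\epsilon\subset\bigcap_{k\ge0}(\mathcal Z_2\sim\mathcal P_\beta(k))$. Then $\tilde O_{\infty,\mu}=\bar\Phi\cap\bigcap_{k\ge0}\Phi_k$. Recoverable set: $\mathcal R_{\mu}^{T_r}$ is the set of states $x(t)$ for which there exist $v(t),\dots,v(t+T_r-1)$ such that $\hat z_1(k|t,\mu)\in\mathcal Z_1^+$, $\hat z_2(k|t,\mu)\in\mathcal Z_2^+\sim\mathcal P_\beta(k)$ for all $k\in\{0,\dots,T_r-1\}$, and $(\hat x(T_r|t,\mu),v(t+T_r-1))\in\mathrm{Proj}_{(x,v_0)}\tilde O_{\infty,\mu}$. Detection cost: let $\tilde{\mathcal M}$ be the set of models $\tilde\mu$ indexed by $\bar\mu\in\{\mu\}\cup\mathcal M_\mu^+$, with matrices $(A_{\tilde\mu},B_{\tilde\mu})=(A_{o,\bar\mu}+B_{o,\bar\mu}K_\mu,B_{o,\bar\mu}G_\mu)$, process noise covariance $H_{\omega_{\bar\mu}}$, and known prior probabilities $\mathbb{P}(\tilde\mu)$. Then $$\hat J_d(v_0,\dots,v_{T_d-1})=\tfrac12\sum_{\tilde\mu\in\tilde{\mathcal M}}\sum_{\check\mu\in\tilde{\mathcal M}}\sqrt{\mathbb{P}(\tilde\mu)\mathbb{P}(\check\mu)}\,e^{-\rho_{\tilde\mu\check\mu}},$$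 $$\rho_{\tilde\mu\check\mu}=\tfrac14(\eta_{\tilde\mu}-\eta_{\check\mu})^\top(\Psi_{\tilde\mu}+\Psi_{\check\mu})^{-1}(\eta_{\tilde\mu}-\eta_{\check\mu})+\tfrac12\ln\frac{\det\big((\Psi_{\tilde\mu}+\Psi_{\check\mu})/2\big)}{\sqrt{\det\Psi_{\tilde\mu}\det\Psi_{\check\mu}}},$$ where $\eta_{\tilde\mu}$ stacks $C\hat x(0|t,\tilde\mu),\dots,C\hat x(T_d|t,\tilde\mu)$ (noise-free predictions with model $\tilde\mu$ under $v_0,\dots,v_{T_d-1}$), $\Psi_{\tilde\mu}$ is block diagonal with blocks $C\Sigma(0)C^\top,\ C\Sigma(1|\tilde\mu)C^\top+H_\xi,\dots,C\Sigma(T_d|\tilde\mu)C^\top+H_\xi$, and $\Sigma(k+1|\tilde\mu)=A_{\tilde\mu}\Sigma(k|\tilde\mu)A_{\tilde\mu}^\top+H_{\omega_{\bar\mu}}$ with $\Sigma(0)$ the covariance of the state measurement or estimate.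
   Formalization: A mode change within the interval is assumed to occur right at its beginning (one successor mode governs all later steps); for a change after the first step, possible when T_d ≥ 3, the claim that the relaxed constraints hold is false. Z_2^+ is taken to be Borel. *)

theory Defs
  imports "HOL-Probability.Probability"
begin

section \<open>Matrices and sets\<close>

text \<open>
  The overloaded power on vectors of vectors is componentwise, so the matrix power is
  defined by iterating the matrix product.
\<close>

primrec mat_power :: "real^'n^'n \<Rightarrow> nat \<Rightarrow> real^'n^'n" where
  "mat_power A 0 = mat 1"
| "mat_power A (Suc k) = A ** mat_power A k"

definition strictly_schur :: "real^'n^'n \<Rightarrow> bool" where
  "strictly_schur A \<longleftrightarrow>
     (\<forall>(l::complex) w. w \<noteq> 0 \<and> map_matrix complex_of_real A *v w = l *s w \<longrightarrow> norm l < 1)"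

text \<open>Distinct initial states produce distinct free output responses.\<close>

definition observable_pair :: "real^'n^'l \<Rightarrow> real^'n^'n \<Rightarrow> bool" where
  "observable_pair L A \<longleftrightarrow>
     (\<forall>x y. (\<forall>k. L *v (mat_power A k *v x) = L *v (mat_power A k *v y)) \<longrightarrow> x = y)"

definition pos_semidef :: "real^'n^'n \<Rightarrow> bool" where
  "pos_semidef H \<longleftrightarrow> transpose H = H \<and> (\<forall>a. 0 \<le> a \<bullet> (H *v a))"

definition pos_def :: "real^'n^'n \<Rightarrow> bool" where
  "pos_def H \<longleftrightarrow> transpose H = H \<and> (\<forall>a. a \<noteq> 0 \<longrightarrow> 0 < a \<bullet> (H *v a))"

definition pontryagin_diff :: "('a::plus) set \<Rightarrow> 'a set \<Rightarrow> 'a set" where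
  "pontryagin_diff X Y = {x. \<forall>y\<in>Y. x + y \<in> X}"

section \<open>Gaussian vectors and confidence ellipsoids\<close>

definition centered_normal :: "real \<Rightarrow> real measure" where
  "centered_normal s2 =
     (if s2 = 0 then return borel 0 else density lborel (normal_density 0 (sqrt s2)))"

text \<open>
  Law \<open>N(0, H)\<close>, with singular \<open>H\<close> allowed: every linear functional \<open>a\<close> is
  distributed according to \<open>N(0, a\<^sup>T H a)\<close>.
\<close>

definition gaussian_vector :: "'w measure \<Rightarrow> real^'n^'n \<Rightarrow> ('w \<Rightarrow> real^'n) \<Rightarrow> bool" where
  "gaussian_vector M H X \<longleftrightarrow>
     X \<in> borel_measurable M \<and>
     (\<forall>a. distr M borel (\<lambda>w. a \<bullet> X w) = centered_normal (a \<bullet> (H *v a)))"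

definition cov_matrix :: "'w measure \<Rightarrow> ('w \<Rightarrow> real^'n) \<Rightarrow> real^'n^'n" where
  "cov_matrix M X =
     (let m = (\<integral>w. X w \<partial>M) in \<chi> i j. (\<integral>w. (X w - m) $ i * (X w - m) $ j \<partial>M))"

text \<open>
  For a centered random vector \<open>X\<close> with covariance \<open>S\<close>: if \<open>S\<close> is invertible and
  \<open>S = L L\<^sup>T\<close>, then the image of the ball of radius \<open>\<rho>\<close> under \<open>L\<close> is
  the set of all \<open>z\<close> with \<open>z\<^sup>T S\<^sup>-\<^sup>1 z \<le> \<rho>\<^sup>2\<close>. The image form also covers
  degenerate ellipsoids and does not depend on the choice of the factor \<open>L\<close>.
\<close>

definition confidence_ellipsoid ::
  "'w measure \<Rightarrow> real \<Rightarrow> ('w \<Rightarrow> real^'n) \<Rightarrow> (real^'n) set \<Rightarrow> bool" where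
  "confidence_ellipsoid M \<beta> X P \<longleftrightarrow>
     (\<exists>(L::real^'n^'n) \<rho>. 0 \<le> \<rho> \<and> L ** transpose L = cov_matrix M X \<and>
        P = (\<lambda>a. L *v a) ` cball 0 \<rho>) \<and>
     measure M {w \<in> space M. X w \<in> P} = \<beta>"

section \<open>The multi-mode system\<close>

text \<open>
  The type parameters are: \<open>'q\<close> for modes, and index types for the state (\<open>'n\<close>), the
  control (\<open>'p\<close>), the measured output and the auxiliary reference (\<open>'m\<close>), and the two
  constrained outputs (\<open>'e\<close>, \<open>'c\<close>).
\<close>

record ('q, 'n::finite, 'p::finite, 'm::finite, 'e::finite, 'c::finite) multimode =
  modes :: "'q set"
  successors :: "'q \<Rightarrow> 'q set"
  Ao :: "'q \<Rightarrow> real^'n^'n"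
  Bo :: "'q \<Rightarrow> real^'p^'n"
  Kgain :: "'q \<Rightarrow> real^'n^'p"
  Ggain :: "'q \<Rightarrow> real^'m^'p"
  Cy :: "real^'n^'m"
  Lx :: "real^'n^'e"
  Lv :: "real^'m^'e"
  Fx :: "real^'n^'c"
  Fv :: "real^'m^'c"
  Homega :: "'q \<Rightarrow> real^'n^'n"
  Hxi :: "real^'m^'m"
  Hzeta1 :: "real^'e^'e"
  Hzeta2 :: "real^'c^'c"
  Sigma0 :: "real^'n^'n"
  Z1 :: "(real^'e) set"
  Z2 :: "(real^'c) set"
  Z1ext :: "(real^'e) set"
  Z2ext :: "(real^'c) set"
  level :: real
  eps :: real
  Td :: nat
  Tr :: nat
  Te :: nat

text \<open>\<open>Acl S \<nu> \<kappa>\<close> and \<open>Bcl S \<nu> \<kappa>\<close>: the gains for mode \<open>\<kappa>\<close> applied to the plant in mode \<open>\<nu>\<close>.\<close>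

definition Acl :: "('q,'n::finite,'p::finite,'m::finite,'e::finite,'c::finite) multimode
    \<Rightarrow> 'q \<Rightarrow> 'q \<Rightarrow> real^'n^'n" where
  "Acl S \<nu> \<kappa> = Ao S \<nu> + Bo S \<nu> ** Kgain S \<kappa>"

definition Bcl :: "('q,'n::finite,'p::finite,'m::finite,'e::finite,'c::finite) multimode
    \<Rightarrow> 'q \<Rightarrow> 'q \<Rightarrow> real^'m^'n" where
  "Bcl S \<nu> \<kappa> = Bo S \<nu> ** Ggain S \<kappa>"

text \<open>
  \<open>Z2ext\<close> is required to be a Borel set because the probability of \<open>z2\<close> lying in it has to be
  meaningful; for \<open>Z2\<close> this follows from compactness.
\<close>

definition standing_assumptions ::
  "('q,'n::finite,'p::finite,'m::finite,'e::finite,'c::finite) multimode \<Rightarrow> bool" where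
  "standing_assumptions S \<longleftrightarrow>
     finite (modes S) \<and> (\<forall>\<mu>\<in>modes S. successors S \<mu> \<subseteq> modes S) \<and>
     (\<forall>\<mu>\<in>modes S. strictly_schur (Acl S \<mu> \<mu>) \<and>
        observable_pair (Lx S) (Acl S \<mu> \<mu>) \<and> observable_pair (Fx S) (Acl S \<mu> \<mu>) \<and>
        pos_semidef (Homega S \<mu>)) \<and>
     pos_semidef (Hxi S) \<and> pos_semidef (Hzeta1 S) \<and> pos_semidef (Hzeta2 S) \<and>
     pos_semidef (Sigma0 S) \<and>
     compact (Z1 S) \<and> convex (Z1 S) \<and> 0 \<in> Z1 S \<and>
     compact (Z2 S) \<and> convex (Z2 S) \<and> 0 \<in> Z2 S \<and>
     Z1 S \<subseteq> Z1ext S \<and> Z2 S \<subseteq> Z2ext S \<and> Z2ext S \<in> sets borel \<and>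
     0 < eps S \<and> 1 \<le> Td S \<and> 2 \<le> Te S \<and> 0 < Tr S \<and> Tr S + 2 * Td S < Te S"

text \<open>
  The disturbances \<open>\<omega>\<^sub>\<nu>(s)\<close> (for all modes \<open>\<nu>\<close> and times \<open>s\<close>) and \<open>\<xi>(s)\<close> (for all
  times) form one independent family; independence is expressed through the generated
  \<open>\<sigma>\<close>-algebras because the two kinds of vectors have different types.
\<close>

definition noise_model ::
  "'w measure \<Rightarrow> ('q,'n::finite,'p::finite,'m::finite,'e::finite,'c::finite) multimode \<Rightarrow>
   ('q \<Rightarrow> int \<Rightarrow> 'w \<Rightarrow> real^'n) \<Rightarrow> (int \<Rightarrow> 'w \<Rightarrow> real^'m) \<Rightarrow>
   (int \<Rightarrow> 'w \<Rightarrow> real^'e) \<Rightarrow> (int \<Rightarrow> 'w \<Rightarrow> real^'c) \<Rightarrow> bool" where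
  "noise_model M S \<omega> \<xi> \<zeta>1 \<zeta>2 \<longleftrightarrow>
     (\<forall>\<nu>\<in>modes S. \<forall>s. gaussian_vector M (Homega S \<nu>) (\<omega> \<nu> s)) \<and>
     (\<forall>s. gaussian_vector M (Hxi S) (\<xi> s)) \<and>
     (\<forall>s. gaussian_vector M (Hzeta1 S) (\<zeta>1 s)) \<and>
     (\<forall>s. gaussian_vector M (Hzeta2 S) (\<zeta>2 s)) \<and>
     prob_space.indep_sets M
       (\<lambda>i. case i of
              Inl (\<nu>, s) \<Rightarrow> {\<omega> \<nu> s -` E \<inter> space M | E. E \<in> sets borel}
            | Inr s \<Rightarrow> {\<xi> s -` E \<inter> space M | E. E \<in> sets borel})
       (Inl ` (modes S \<times> UNIV) \<union> range Inr)"

section \<open>Predictions\<close>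

primrec pred_state :: "real^'n^'n \<Rightarrow> real^'m^'n \<Rightarrow> real^'n \<Rightarrow> (nat \<Rightarrow> real^'m) \<Rightarrow> nat \<Rightarrow> real^'n"
  where
  "pred_state A B x v 0 = x"
| "pred_state A B x v (Suc k) = A *v pred_state A B x v k + B *v v k"

definition pred_z1 :: "('q,'n::finite,'p::finite,'m::finite,'e::finite,'c::finite) multimode
    \<Rightarrow> 'q \<Rightarrow> 'q \<Rightarrow> real^'n \<Rightarrow> (nat \<Rightarrow> real^'m) \<Rightarrow> nat \<Rightarrow> real^'e" where
  "pred_z1 S \<nu> \<kappa> x v k = Lx S *v pred_state (Acl S \<nu> \<kappa>) (Bcl S \<nu> \<kappa>) x v k + Lv S *v v k"

definition pred_z2 :: "('q,'n::finite,'p::finite,'m::finite,'e::finite,'c::finite) multimode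
    \<Rightarrow> 'q \<Rightarrow> 'q \<Rightarrow> real^'n \<Rightarrow> (nat \<Rightarrow> real^'m) \<Rightarrow> nat \<Rightarrow> real^'c" where
  "pred_z2 S \<nu> \<kappa> x v k = Fx S *v pred_state (Acl S \<nu> \<kappa>) (Bcl S \<nu> \<kappa>) x v k + Fv S *v v k"

definition hold_last :: "nat \<Rightarrow> (nat \<Rightarrow> 'a) \<Rightarrow> nat \<Rightarrow> 'a" where
  "hold_last N v k = v (min k (N - 1))"

primrec noise_state :: "real^'n^'n \<Rightarrow> (nat \<Rightarrow> 'w \<Rightarrow> real^'n) \<Rightarrow> nat \<Rightarrow> 'w \<Rightarrow> real^'n" where
  "noise_state A \<omega> 0 w = 0"
| "noise_state A \<omega> (Suc k) w = A *v noise_state A \<omega> k w + \<omega> k w"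

definition noise_z2 :: "('q,'n::finite,'p::finite,'m::finite,'e::finite,'c::finite) multimode \<Rightarrow>
    ('q \<Rightarrow> int \<Rightarrow> 'w \<Rightarrow> real^'n) \<Rightarrow> (int \<Rightarrow> 'w \<Rightarrow> real^'c) \<Rightarrow>
    'q \<Rightarrow> 'q \<Rightarrow> int \<Rightarrow> nat \<Rightarrow> 'w \<Rightarrow> real^'c" where
  "noise_z2 S \<omega> \<zeta>2 \<nu> \<kappa> t k w =
     Fx S *v noise_state (Acl S \<nu> \<kappa>) (\<lambda>j. \<omega> \<nu> (t + int j)) k w + \<zeta>2 (t + int k) w"

section \<open>The sets of admissible references and of recoverable states\<close>

text \<open>
  \<open>Pb \<nu> \<kappa> k\<close> stands for the level-\<open>\<beta>\<close> confidence ellipsoid of the noise-driven prediction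
  of \<open>z2\<close> at step \<open>k\<close>, for plant mode \<open>\<nu>\<close> under the gains for \<open>\<kappa>\<close>.
  Sequences are functions on \<open>nat\<close> of which only the entries \<open>0, \<dots>, Td - 1\<close> are relevant.
\<close>

definition ss_state :: "('q,'n::finite,'p::finite,'m::finite,'e::finite,'c::finite) multimode
    \<Rightarrow> 'q \<Rightarrow> real^'m^'n" where
  "ss_state S \<mu> = matrix_inv (mat 1 - Acl S \<mu> \<mu>) ** Bcl S \<mu> \<mu>"

definition ss_z1 :: "('q,'n::finite,'p::finite,'m::finite,'e::finite,'c::finite) multimode
    \<Rightarrow> 'q \<Rightarrow> real^'m^'e" where
  "ss_z1 S \<mu> = Lx S ** ss_state S \<mu> + Lv S"

definition ss_z2 :: "('q,'n::finite,'p::finite,'m::finite,'e::finite,'c::finite) multimode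
    \<Rightarrow> 'q \<Rightarrow> real^'m^'c" where
  "ss_z2 S \<mu> = Fx S ** ss_state S \<mu> + Fv S"

definition tail_z1 :: "('q,'n::finite,'p::finite,'m::finite,'e::finite,'c::finite) multimode
    \<Rightarrow> 'q \<Rightarrow> nat \<Rightarrow> real^'n \<Rightarrow> (nat \<Rightarrow> real^'m) \<Rightarrow> real^'e" where
  "tail_z1 S \<mu> k x v =
     (let T = Td S - 1; xT = pred_state (Acl S \<mu> \<mu>) (Bcl S \<mu> \<mu>) x v T in
      Lx S *v (mat_power (Acl S \<mu> \<mu>) k *v (xT - ss_state S \<mu> *v v T)) + ss_z1 S \<mu> *v v T)"

definition tail_z2 :: "('q,'n::finite,'p::finite,'m::finite,'e::finite,'c::finite) multimode
    \<Rightarrow> 'q \<Rightarrow> nat \<Rightarrow> real^'n \<Rightarrow> (nat \<Rightarrow> real^'m) \<Rightarrow> real^'c" where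
  "tail_z2 S \<mu> k x v =
     (let T = Td S - 1; xT = pred_state (Acl S \<mu> \<mu>) (Bcl S \<mu> \<mu>) x v T in
      Fx S *v (mat_power (Acl S \<mu> \<mu>) k *v (xT - ss_state S \<mu> *v v T)) + ss_z2 S \<mu> *v v T)"

definition Phi_set :: "('q,'n::finite,'p::finite,'m::finite,'e::finite,'c::finite) multimode \<Rightarrow>
    ('q \<Rightarrow> 'q \<Rightarrow> nat \<Rightarrow> (real^'c) set) \<Rightarrow> 'q \<Rightarrow> nat \<Rightarrow> ((real^'n) \<times> (nat \<Rightarrow> real^'m)) set" where
  "Phi_set S Pb \<mu> k =
     {(x, v). tail_z1 S \<mu> k x v \<in> Z1 S \<and>
              tail_z2 S \<mu> k x v \<in> pontryagin_diff (Z2 S) (Pb \<mu> \<mu> k)}"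

definition Phi_bar :: "('q,'n::finite,'p::finite,'m::finite,'e::finite,'c::finite) multimode \<Rightarrow>
    ('q \<Rightarrow> 'q \<Rightarrow> nat \<Rightarrow> (real^'c) set) \<Rightarrow> 'q \<Rightarrow> ((real^'n) \<times> (nat \<Rightarrow> real^'m)) set" where
  "Phi_bar S Pb \<mu> =
     {(x, v).
        (\<forall>k \<le> Td S - 1. pred_z1 S \<mu> \<mu> x v k \<in> Z1 S \<and>
                        pred_z2 S \<mu> \<mu> x v k \<in> pontryagin_diff (Z2 S) (Pb \<mu> \<mu> k)) \<and>
        {ss_z1 S \<mu> *v v (Td S - 1)} + ball 0 (eps S) \<subseteq> Z1 S \<and>
        {ss_z2 S \<mu> *v v (Td S - 1)} + ball 0 (eps S)
          \<subseteq> (\<Inter>k. pontryagin_diff (Z2 S) (Pb \<mu> \<mu> k))}"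

definition O_tilde :: "('q,'n::finite,'p::finite,'m::finite,'e::finite,'c::finite) multimode \<Rightarrow>
    ('q \<Rightarrow> 'q \<Rightarrow> nat \<Rightarrow> (real^'c) set) \<Rightarrow> 'q \<Rightarrow> ((real^'n) \<times> (nat \<Rightarrow> real^'m)) set" where
  "O_tilde S Pb \<mu> = Phi_bar S Pb \<mu> \<inter> (\<Inter>k. Phi_set S Pb \<mu> k)"

definition proj_xv0 :: "('a \<times> (nat \<Rightarrow> 'b)) set \<Rightarrow> ('a \<times> 'b) set" where
  "proj_xv0 X = (\<lambda>(x, v). (x, v 0)) ` X"

definition recoverable :: "('q,'n::finite,'p::finite,'m::finite,'e::finite,'c::finite) multimode \<Rightarrow>
    ('q \<Rightarrow> 'q \<Rightarrow> nat \<Rightarrow> (real^'c) set) \<Rightarrow> 'q \<Rightarrow> (real^'n) set" where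
  "recoverable S Pb \<mu> =
     {x. \<exists>v. (\<forall>k < Tr S. pred_z1 S \<mu> \<mu> x v k \<in> Z1ext S \<and>
                         pred_z2 S \<mu> \<mu> x v k \<in> pontryagin_diff (Z2ext S) (Pb \<mu> \<mu> k)) \<and>
             (pred_state (Acl S \<mu> \<mu>) (Bcl S \<mu> \<mu>) x v (Tr S), v (Tr S - 1))
               \<in> proj_xv0 (O_tilde S Pb \<mu>)}"

section \<open>Detection cost\<close>

primrec state_cov :: "real^'n^'n \<Rightarrow> real^'n^'n \<Rightarrow> real^'n^'n \<Rightarrow> nat \<Rightarrow> real^'n^'n" where
  "state_cov A H \<Sigma>0 0 = \<Sigma>0"
| "state_cov A H \<Sigma>0 (Suc k) = A ** state_cov A H \<Sigma>0 k ** transpose A + H"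

text \<open>
  Stacked vectors over the time instants \<open>0, \<dots>, Td\<close> are indexed by the type \<open>'d \<times> 'm\<close>, where
  \<open>\<tau>\<close> enumerates these instants by the elements of \<open>'d\<close>.
\<close>

definition stacked_output :: "('q,'n::finite,'p::finite,'m::finite,'e::finite,'c::finite) multimode
    \<Rightarrow> ('d::finite \<Rightarrow> nat) \<Rightarrow> 'q \<Rightarrow> real^'n \<Rightarrow> (nat \<Rightarrow> real^'m) \<Rightarrow> 'q \<Rightarrow> real^('d \<times> 'm)" where
  "stacked_output S \<tau> \<mu> x v \<nu> =
     (\<chi> i. (Cy S *v pred_state (Acl S \<nu> \<mu>) (Bcl S \<nu> \<mu>) x v (\<tau> (fst i))) $ snd i)"

definition output_cov :: "('q,'n::finite,'p::finite,'m::finite,'e::finite,'c::finite) multimode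
    \<Rightarrow> 'q \<Rightarrow> 'q \<Rightarrow> nat \<Rightarrow> real^'m^'m" where
  "output_cov S \<mu> \<nu> k =
     Cy S ** state_cov (Acl S \<nu> \<mu>) (Homega S \<nu>) (Sigma0 S) k ** transpose (Cy S)
     + (if k = 0 then 0 else Hxi S)"

definition stacked_cov :: "('q,'n::finite,'p::finite,'m::finite,'e::finite,'c::finite) multimode
    \<Rightarrow> ('d::finite \<Rightarrow> nat) \<Rightarrow> 'q \<Rightarrow> 'q \<Rightarrow> real^('d \<times> 'm)^('d \<times> 'm)" where
  "stacked_cov S \<tau> \<mu> \<nu> =
     (\<chi> i j. if fst i = fst j then output_cov S \<mu> \<nu> (\<tau> (fst i)) $ snd i $ snd j else 0)"

definition bhattacharyya :: "real^'k^'k \<Rightarrow> real^'k^'k \<Rightarrow> real^'k \<Rightarrow> real^'k \<Rightarrow> real" where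
  "bhattacharyya \<Psi> \<Psi>' \<eta> \<eta>' =
     1/4 * ((\<eta> - \<eta>') \<bullet> (matrix_inv (\<Psi> + \<Psi>') *v (\<eta> - \<eta>')))
     + 1/2 * ln (det ((1/2) *\<^sub>R (\<Psi> + \<Psi>')) / sqrt (det \<Psi> * det \<Psi>'))"

definition detection_cost :: "('q,'n::finite,'p::finite,'m::finite,'e::finite,'c::finite) multimode
    \<Rightarrow> ('d::finite \<Rightarrow> nat) \<Rightarrow> ('q \<Rightarrow> real) \<Rightarrow> 'q \<Rightarrow> real^'n \<Rightarrow> (nat \<Rightarrow> real^'m) \<Rightarrow> real" where
  "detection_cost S \<tau> prior \<mu> x v =
     1/2 * (\<Sum>\<nu>\<in>insert \<mu> (successors S \<mu>). \<Sum>\<nu>'\<in>insert \<mu> (successors S \<mu>).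
        sqrt (prior \<nu> * prior \<nu>') *
        exp (- bhattacharyya (stacked_cov S \<tau> \<mu> \<nu>) (stacked_cov S \<tau> \<mu> \<nu>')
                 (stacked_output S \<tau> \<mu> x v \<nu>) (stacked_output S \<tau> \<mu> x v \<nu>')))"

section \<open>The optimization problem\<close>

definition objective :: "('q,'n::finite,'p::finite,'m::finite,'e::finite,'c::finite) multimode \<Rightarrow>
    ('d::finite \<Rightarrow> nat) \<Rightarrow> ('q \<Rightarrow> real) \<Rightarrow> real^'m^'m \<Rightarrow> real \<Rightarrow> real^'m \<Rightarrow>
    'q \<Rightarrow> real^'n \<Rightarrow> (nat \<Rightarrow> real^'m) \<Rightarrow> real" where
  "objective S \<tau> prior R \<Omega> r \<mu> x v =
     \<Omega> * (\<Sum>i<Td S. (v i - r) \<bullet> (R *v (v i - r)))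
     + (1 - \<Omega>) * detection_cost S \<tau> prior \<mu> x v"

definition feasible :: "('q,'n::finite,'p::finite,'m::finite,'e::finite,'c::finite) multimode \<Rightarrow>
    ('q \<Rightarrow> 'q \<Rightarrow> nat \<Rightarrow> (real^'c) set) \<Rightarrow> real^'m \<Rightarrow> real \<Rightarrow>
    'q \<Rightarrow> real^'n \<Rightarrow> (nat \<Rightarrow> real^'m) \<Rightarrow> bool" where
  "feasible S Pb r \<theta> \<mu> x v \<longleftrightarrow>
     (\<forall>i < Td S. norm (v i - r) \<le> \<theta>) \<and>
     (x, v) \<in> O_tilde S Pb \<mu> \<and>
     (\<forall>\<nu>\<in>successors S \<mu>.
        pred_state (Acl S \<nu> \<mu>) (Bcl S \<nu> \<mu>) x v (Td S) \<in> recoverable S Pb \<nu> \<and>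
        (\<forall>k \<le> Td S.
           pred_z1 S \<nu> \<mu> x (hold_last (Td S) v) k \<in> Z1ext S \<and>
           pred_z2 S \<nu> \<mu> x (hold_last (Td S) v) k
             \<in> pontryagin_diff (Z2ext S) (Pb \<nu> \<mu> k)))"

section \<open>Closed-loop operation over a detection interval\<close>

text \<open>
  \<open>\<sigma> s\<close> is the mode of the system at time \<open>s\<close>, in the sense that \<open>x s\<close> is generated
  from \<open>x (s - 1)\<close> by the dynamics of mode \<open>\<sigma> s\<close>: the state of mode \<open>\<mu>\<close> at
  \<open>t + 1\<close> is obtained with the matrices of \<open>\<mu>\<close>. Hence the prediction with a
  successor mode \<open>\<nu>\<close> started at \<open>x t\<close> describes the operation in which
  \<open>\<sigma> t = \<mu>\<close> and \<open>\<sigma> s = \<nu>\<close> for the later times \<open>s\<close> of the interval. The gains in use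
  are those for \<open>\<mu>\<close> throughout. The state at the beginning of the interval is known, so expectations and probabilities
  below are taken with respect to the disturbances from then on.
\<close>

definition closed_loop ::
  "'w measure \<Rightarrow> ('q,'n::finite,'p::finite,'m::finite,'e::finite,'c::finite) multimode \<Rightarrow>
   ('q \<Rightarrow> int \<Rightarrow> 'w \<Rightarrow> real^'n) \<Rightarrow> (int \<Rightarrow> 'w \<Rightarrow> real^'m) \<Rightarrow>
   (int \<Rightarrow> 'w \<Rightarrow> real^'e) \<Rightarrow> (int \<Rightarrow> 'w \<Rightarrow> real^'c) \<Rightarrow>
   'q \<Rightarrow> (int \<Rightarrow> 'q) \<Rightarrow> (int \<Rightarrow> real^'m) \<Rightarrow> int \<Rightarrow> real^'n \<Rightarrow>
   (int \<Rightarrow> 'w \<Rightarrow> real^'n) \<Rightarrow> (int \<Rightarrow> 'w \<Rightarrow> real^'p) \<Rightarrow> (int \<Rightarrow> 'w \<Rightarrow> real^'m) \<Rightarrow>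
   (int \<Rightarrow> 'w \<Rightarrow> real^'e) \<Rightarrow> (int \<Rightarrow> 'w \<Rightarrow> real^'c) \<Rightarrow> bool" where
  "closed_loop M S \<omega> \<xi> \<zeta>1 \<zeta>2 \<mu> \<sigma> v t xt x u y z1 z2 \<longleftrightarrow>
     (\<forall>w\<in>space M.
        x t w = xt \<and>
        (\<forall>s\<in>{t ..< t + int (Td S) - 1}.
           x (s + 1) w = Ao S (\<sigma> (s + 1)) *v x s w + Bo S (\<sigma> (s + 1)) *v u s w
                         + \<omega> (\<sigma> (s + 1)) s w) \<and>
        (\<forall>s\<in>{t .. t + int (Td S) - 1}.
           u s w = Kgain S \<mu> *v x s w + Ggain S \<mu> *v v s \<and>
           y s w = Cy S *v x s w + \<xi> s w \<and>
           z1 s w = Lx S *v x s w + Lv S *v v s + \<zeta>1 s w \<and>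
           z2 s w = Fx S *v x s w + Fv S *v v s + \<zeta>2 s w))"

text \<open>
  Integrability is part of the expectation constraint, since the integral of a non-integrable
  function is \<open>0\<close> by convention.
\<close>

definition constraints_hold ::
  "'w measure \<Rightarrow> real \<Rightarrow> (real^'e) set \<Rightarrow> (real^'c) set \<Rightarrow>
   ('w \<Rightarrow> real^'e) \<Rightarrow> ('w \<Rightarrow> real^'c) \<Rightarrow> bool" where
  "constraints_hold M \<beta> Y1 Y2 z1 z2 \<longleftrightarrow>
     integrable M z1 \<and> (\<integral>w. z1 w \<partial>M) \<in> Y1 \<and>
     {w \<in> space M. z2 w \<in> Y2} \<in> sets M \<and>
     \<beta> \<le> measure M {w \<in> space M. z2 w \<in> Y2}"

end

theory Submission
  imports Defs
begin

text \<open>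
  Over one interval the gains stay fixed and the plant follows a single mode \<open>\<nu>\<close> after the
  first instant, so the loop is linear and time-invariant. By superposition every constrained
  output is the noise-free prediction with \<open>\<nu>\<close> plus a noise term that depends neither on the
  initial state nor on the reference (\<open>closed_loop_outputs\<close>).

  The noise term of the first output is a linear combination of centered Gaussian vectors, so the
  expected output is the prediction itself. For the second output the prediction lies in the
  Pontryagin difference of the constraint set and the confidence ellipsoid; hence the output meets
  the constraint at least on the event that the noise falls into the ellipsoid, and this event has
  probability exactly \<open>\<beta>\<close>. Membership of the predictions in the tightened sets thus implies the
  stochastic constraints (\<open>closed_loop_constraints_hold\<close>).

  The constraints of the optimization problem provide this membership for every admissible \<open>\<nu>\<close>:
  membership in \<open>O_tilde\<close> gives the nominal sets, and so also the larger relaxed sets, when no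
  mode change takes place, and the constraints indexed by the successor modes give the relaxed
  sets after a change. The minimizer satisfies them because it is feasible.
\<close>

section \<open>Disturbances have mean zero\<close>

lemma centered_normal_mean:
  assumes "0 \<le> s2"
  shows "integrable (centered_normal s2) (\<lambda>x. x)" "(\<integral>x. x \<partial>centered_normal s2) = 0"
proof -
  have "integrable (centered_normal s2) (\<lambda>x. x) \<and> (\<integral>x. x \<partial>centered_normal s2) = 0"
  proof (cases "s2 = 0")
    case True
    then have point: "centered_normal s2 = return borel 0"
      by (simp add: centered_normal_def)
    have "(\<integral>\<^sup>+x. ennreal (norm (x::real)) \<partial>return borel 0) = 0"
      by (subst nn_integral_return) simp_all
    then have "integrable (return borel (0::real)) (\<lambda>x. x)"
      by (intro integrableI_bounded) simp_all
    moreover have "(\<integral>x. x \<partial>return borel (0::real)) = 0"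
      by (subst integral_return) simp_all
    ultimately show ?thesis unfolding point ..
  next
    case False
    then have pos: "0 < sqrt s2" using assms by simp
    note moment = integrable_normal_moment_nz_1[OF pos, of 0] integral_normal_moment_nz_1[OF pos, of 0]
    have density: "centered_normal s2 = density lborel (\<lambda>x. ennreal (normal_density 0 (sqrt s2) x))"
      using False by (simp add: centered_normal_def)
    have "integrable (centered_normal s2) (\<lambda>x. x)"
      unfolding density using moment(1) by (subst integrable_density) simp_all
    moreover have "(\<integral>x. x \<partial>centered_normal s2) = 0"
      unfolding density using moment(2) by (subst integral_density) simp_all
    ultimately show ?thesis ..
  qed
  then show "integrable (centered_normal s2) (\<lambda>x. x)" "(\<integral>x. x \<partial>centered_normal s2) = 0"
    by auto
qed

text \<open>
  Integrability is part of the notion because the integral of a non-integrable function is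
  \<open>0\<close> by convention; it also makes the class closed under the linear operations below.
\<close>

definition zero_mean :: "'w measure \<Rightarrow> ('w \<Rightarrow> 'a::euclidean_space) \<Rightarrow> bool" where
  "zero_mean M X \<longleftrightarrow> integrable M X \<and> (\<integral>w. X w \<partial>M) = 0"

lemma zero_mean_zero: "zero_mean M (\<lambda>w. 0)"
  by (simp add: zero_mean_def)

lemma zero_mean_add:
  "zero_mean M X \<Longrightarrow> zero_mean M Y \<Longrightarrow> zero_mean M (\<lambda>w. X w + Y w)"
  by (simp add: zero_mean_def)

lemma zero_mean_sum:
  "(\<And>i. i \<in> I \<Longrightarrow> zero_mean M (X i)) \<Longrightarrow> zero_mean M (\<lambda>w. \<Sum>i\<in>I. X i w)"
  by (simp add: zero_mean_def)

lemma zero_mean_matrix: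
  fixes A :: "real^'n^'k"
  assumes "zero_mean M X"
  shows "zero_mean M (\<lambda>w. A *v X w)"
  using assms integrable_bounded_linear[OF matrix_vector_mul_bounded_linear, of M X A]
    integral_bounded_linear[OF matrix_vector_mul_bounded_linear, of M X A]
  by (simp add: zero_mean_def)

text \<open>
  The law of a Gaussian vector is specified through its linear functionals, so the mean of the
  vector is assembled from the means of its coordinates.
\<close>

lemma gaussian_vector_zero_mean:
  fixes X :: "'w \<Rightarrow> real^'n"
  assumes X: "gaussian_vector M H X" and H: "pos_semidef H"
  shows "zero_mean M X"
proof -
  have meas [measurable]: "X \<in> borel_measurable M"
    using X by (simp add: gaussian_vector_def)
  have functional: "integrable M (\<lambda>w. a \<bullet> X w)" "(\<integral>w. a \<bullet> X w \<partial>M) = 0" for a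
  proof -
    have law: "distr M borel (\<lambda>w. a \<bullet> X w) = centered_normal (a \<bullet> (H *v a))"
      using X by (simp add: gaussian_vector_def)
    have "0 \<le> a \<bullet> (H *v a)" using H by (simp add: pos_semidef_def)
    note mean = centered_normal_mean[OF this, folded law]
    show "integrable M (\<lambda>w. a \<bullet> X w)" "(\<integral>w. a \<bullet> X w \<partial>M) = 0"
      using mean by (simp_all add: integrable_distr_eq integral_distr)
  qed
  have expansion: "(\<lambda>w. \<Sum>a\<in>Basis. (a \<bullet> X w) *\<^sub>R a) = X"
    by (simp add: inner_commute[of _ "X _"] euclidean_representation)
  have "zero_mean M (\<lambda>w. \<Sum>a\<in>Basis. (a \<bullet> X w) *\<^sub>R a)"
    by (intro zero_mean_sum) (auto simp: zero_mean_def functional)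
  then show ?thesis
    unfolding expansion .
qed

lemma noise_state_zero_mean:
  assumes "\<And>k. zero_mean M (\<omega> k)"
  shows "zero_mean M (noise_state A \<omega> k)"
proof (induction k)
  case 0
  then show ?case by (simp add: zero_mean_zero)
next
  case (Suc k)
  then show ?case
    using zero_mean_add[OF zero_mean_matrix[OF Suc] assms] by simp
qed

section \<open>Superposition of prediction and noise\<close>

lemma pred_state_cong:
  "(\<And>j. j < k \<Longrightarrow> v j = v' j) \<Longrightarrow> pred_state A B x v k = pred_state A B x v' k"
  by (induction k) auto

text \<open>
  The affine recursion separates into a part driven by the initial state and the input, and a
  part driven by the disturbance. Only the path of a single outcome \<open>w\<close> is involved, so \<open>X\<close> is
  a plain sequence of vectors.
\<close>

lemma superposition:
  assumes "X 0 = x"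
    and "\<And>j. j < k \<Longrightarrow> X (Suc j) = A *v X j + B *v v j + \<omega> j w"
  shows "X k = pred_state A B x v k + noise_state A \<omega> k w"
  using assms(2)
proof (induction k)
  case 0
  then show ?case by (simp add: assms(1))
next
  case (Suc k)
  then have "X k = pred_state A B x v k + noise_state A \<omega> k w" by simp
  then show ?case using Suc.prems[of k] by (simp add: matrix_vector_right_distrib)
qed

text \<open>
  The mode at time \<open>s + 1\<close> governs the step from \<open>s\<close> to \<open>s + 1\<close>, so the states of the
  interval depend only on the modes strictly after \<open>t\<close>. This is why a change of mode right
  after \<open>t\<close> is still described by the prediction with one single mode \<open>\<nu>\<close>.
\<close>

lemma closed_loop_outputs:
  assumes cl: "closed_loop M S \<omega> \<xi> \<zeta>1 \<zeta>2 \<mu> \<sigma> v t xt x u y z1 z2"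
    and mode: "\<And>s. t < s \<Longrightarrow> s \<le> t + int (Td S) - 1 \<Longrightarrow> \<sigma> s = \<nu>"
    and ref: "\<And>i. i < Td S \<Longrightarrow> v (t + int i) = q i"
    and k: "k < Td S" and w: "w \<in> space M"
  shows "z1 (t + int k) w = pred_z1 S \<nu> \<mu> xt q k +
           (Lx S *v noise_state (Acl S \<nu> \<mu>) (\<lambda>j. \<omega> \<nu> (t + int j)) k w + \<zeta>1 (t + int k) w)"
    and "z2 (t + int k) w = pred_z2 S \<nu> \<mu> xt q k + noise_z2 S \<omega> \<zeta>2 \<nu> \<mu> t k w"
proof -
  have init: "x t w = xt"
    and dyn: "\<And>s. s \<in> {t ..< t + int (Td S) - 1} \<Longrightarrow>
      x (s + 1) w = Ao S (\<sigma> (s + 1)) *v x s w + Bo S (\<sigma> (s + 1)) *v u s w + \<omega> (\<sigma> (s + 1)) s w"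
    and out: "\<And>s. s \<in> {t .. t + int (Td S) - 1} \<Longrightarrow>
      u s w = Kgain S \<mu> *v x s w + Ggain S \<mu> *v v s \<and>
      z1 s w = Lx S *v x s w + Lv S *v v s + \<zeta>1 s w \<and>
      z2 s w = Fx S *v x s w + Fv S *v v s + \<zeta>2 s w"
    using cl w unfolding closed_loop_def by auto
  have step: "x (t + int (Suc j)) w =
      Acl S \<nu> \<mu> *v x (t + int j) w + Bcl S \<nu> \<mu> *v q j + \<omega> \<nu> (t + int j) w" if "j < k" for j
  proof -
    have "t + int j \<in> {t ..< t + int (Td S) - 1}" "t + int j \<in> {t .. t + int (Td S) - 1}"
      using that k by auto
    note dyn[OF this(1)] out[OF this(2)]
    moreover have "\<sigma> (t + int j + 1) = \<nu>" using that k by (intro mode) auto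
    moreover have "v (t + int j) = q j" using that k by (intro ref) auto
    ultimately have
      "x (t + int j + 1) w = Ao S \<nu> *v x (t + int j) w
         + Bo S \<nu> *v (Kgain S \<mu> *v x (t + int j) w + Ggain S \<mu> *v q j) + \<omega> \<nu> (t + int j) w"
      by simp
    then show ?thesis
      by (simp add: Acl_def Bcl_def matrix_vector_mult_add_rdistrib matrix_vector_right_distrib
          matrix_vector_mul_assoc add.assoc add.commute[of 1])
  qed
  have state: "x (t + int k) w = pred_state (Acl S \<nu> \<mu>) (Bcl S \<nu> \<mu>) xt q k
      + noise_state (Acl S \<nu> \<mu>) (\<lambda>j. \<omega> \<nu> (t + int j)) k w"
    by (rule superposition[where X = "\<lambda>j. x (t + int j) w"]) (use init step in auto)
  have "t + int k \<in> {t .. t + int (Td S) - 1}" using k by auto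
  from out[OF this] have "z1 (t + int k) w = Lx S *v x (t + int k) w + Lv S *v q k + \<zeta>1 (t + int k) w"
    "z2 (t + int k) w = Fx S *v x (t + int k) w + Fv S *v q k + \<zeta>2 (t + int k) w"
    using ref[OF k] by simp_all
  then show "z1 (t + int k) w = pred_z1 S \<nu> \<mu> xt q k +
           (Lx S *v noise_state (Acl S \<nu> \<mu>) (\<lambda>j. \<omega> \<nu> (t + int j)) k w + \<zeta>1 (t + int k) w)"
    and "z2 (t + int k) w = pred_z2 S \<nu> \<mu> xt q k + noise_z2 S \<omega> \<zeta>2 \<nu> \<mu> t k w"
    by (simp_all add: state pred_z1_def pred_z2_def noise_z2_def matrix_vector_right_distrib)
qed

section \<open>From tightened deterministic constraints to stochastic ones\<close>

text \<open>
  Two elementary observations carry this: a centered noise leaves the mean at \<open>c1\<close>, and if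
  \<open>c2\<close> lies in the Pontryagin difference, the event that \<open>n2\<close> lies in \<open>P\<close> is contained in
  the event that \<open>c2 + n2\<close> lies in \<open>Y2\<close>.
\<close>

lemma constraints_hold_shifted_noise:
  fixes n1 :: "'w \<Rightarrow> real^'e" and n2 :: "'w \<Rightarrow> real^'c"
  assumes M: "prob_space M"
    and z1: "\<And>w. w \<in> space M \<Longrightarrow> z1 w = c1 + n1 w"
    and z2: "\<And>w. w \<in> space M \<Longrightarrow> z2 w = c2 + n2 w"
    and n1: "zero_mean M n1" and n2: "n2 \<in> borel_measurable M"
    and level: "measure M {w \<in> space M. n2 w \<in> P} = \<beta>"
    and c1: "c1 \<in> Y1" and c2: "c2 \<in> pontryagin_diff Y2 P" and Y2: "Y2 \<in> sets borel"
  shows "constraints_hold M \<beta> Y1 Y2 z1 z2"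
proof -
  interpret prob_space M by (rule M)
  note [measurable] = n2 Y2
  have "integrable M z1 \<longleftrightarrow> integrable M (\<lambda>w. c1 + n1 w)"
    by (rule Bochner_Integration.integrable_cong) (simp_all add: z1)
  then have int: "integrable M z1"
    using n1 by (simp add: zero_mean_def)
  have "(\<integral>w. z1 w \<partial>M) = (\<integral>w. c1 + n1 w \<partial>M)"
    by (rule Bochner_Integration.integral_cong) (simp_all add: z1)
  then have mean: "(\<integral>w. z1 w \<partial>M) = c1"
    using n1 by (simp add: zero_mean_def prob_space)
  have event: "{w \<in> space M. z2 w \<in> Y2} = {w \<in> space M. c2 + n2 w \<in> Y2}"
    using z2 by auto
  have sets: "{w \<in> space M. c2 + n2 w \<in> Y2} \<in> sets M"
    by measurable
  have "measure M {w \<in> space M. n2 w \<in> P} \<le> measure M {w \<in> space M. c2 + n2 w \<in> Y2}"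
    using c2 sets by (intro finite_measure_mono) (auto simp: pontryagin_diff_def)
  then show ?thesis
    unfolding constraints_hold_def event using int mean c1 sets level by simp
qed

text \<open>
  The sets \<open>Y1\<close> and \<open>Y2\<close> are left open so that the same argument serves the nominal and the
  relaxed constraints.
\<close>

lemma closed_loop_constraints_hold:
  assumes M: "prob_space M" and S: "standing_assumptions S"
    and noise: "noise_model M S \<omega> \<xi> \<zeta>1 \<zeta>2"
    and Pb: "confidence_ellipsoid M (level S) (noise_z2 S \<omega> \<zeta>2 \<nu> \<mu> t k) P"
    and \<nu>: "\<nu> \<in> modes S"
    and cl: "closed_loop M S \<omega> \<xi> \<zeta>1 \<zeta>2 \<mu> \<sigma> v t xt x u y z1 z2"
    and mode: "\<And>s. t < s \<Longrightarrow> s \<le> t + int (Td S) - 1 \<Longrightarrow> \<sigma> s = \<nu>"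
    and ref: "\<And>i. i < Td S \<Longrightarrow> v (t + int i) = q i"
    and k: "k < Td S"
    and c1: "pred_z1 S \<nu> \<mu> xt q k \<in> Y1"
    and c2: "pred_z2 S \<nu> \<mu> xt q k \<in> pontryagin_diff Y2 P"
    and Y2: "Y2 \<in> sets borel"
  shows "constraints_hold M (level S) Y1 Y2 (z1 (t + int k)) (z2 (t + int k))"
proof -
  let ?N = "noise_state (Acl S \<nu> \<mu>) (\<lambda>j. \<omega> \<nu> (t + int j)) k"
  have \<omega>: "zero_mean M (\<omega> \<nu> s)" and \<zeta>1: "zero_mean M (\<zeta>1 s)" and \<zeta>2: "zero_mean M (\<zeta>2 s)" for s
    using noise S \<nu> unfolding noise_model_def standing_assumptions_def
    by (blast intro: gaussian_vector_zero_mean)+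
  have N: "zero_mean M ?N"
    by (intro noise_state_zero_mean \<omega>)
  have n1: "zero_mean M (\<lambda>w. Lx S *v ?N w + \<zeta>1 (t + int k) w)"
    by (intro zero_mean_add zero_mean_matrix N \<zeta>1)
  have "zero_mean M (\<lambda>w. Fx S *v ?N w + \<zeta>2 (t + int k) w)"
    by (intro zero_mean_add zero_mean_matrix N \<zeta>2)
  then have n2: "noise_z2 S \<omega> \<zeta>2 \<nu> \<mu> t k \<in> borel_measurable M"
    unfolding zero_mean_def noise_z2_def by (blast intro: borel_measurable_integrable)
  show ?thesis
    using closed_loop_outputs[OF cl mode ref k] Pb
    by (intro constraints_hold_shifted_noise[OF M _ _ n1 n2 _ c1 c2 Y2])
      (auto simp: confidence_ellipsoid_def)
qed

section \<open>The reference computed by the optimization\<close>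

theorem theorem26:
  fixes S :: "('q, 'n::finite, 'p::finite, 'm::finite, 'e::finite, 'c::finite) multimode"
    and M :: "'w measure"
    and \<omega> :: "'q \<Rightarrow> int \<Rightarrow> 'w \<Rightarrow> real^'n" and \<xi> :: "int \<Rightarrow> 'w \<Rightarrow> real^'m"
    and \<zeta>1 :: "int \<Rightarrow> 'w \<Rightarrow> real^'e" and \<zeta>2 :: "int \<Rightarrow> 'w \<Rightarrow> real^'c"
    and Pb :: "'q \<Rightarrow> 'q \<Rightarrow> nat \<Rightarrow> (real^'c) set"
    and \<tau> :: "'d::finite \<Rightarrow> nat" and prior :: "'q \<Rightarrow> real"
    and R :: "real^'m^'m" and \<Omega> \<theta> :: real and r :: "real^'m"
    and \<mu> :: 'q and \<sigma> :: "int \<Rightarrow> 'q" and t :: int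
    and xt :: "real^'n" and v :: "int \<Rightarrow> real^'m" and vopt :: "nat \<Rightarrow> real^'m"
    and x :: "int \<Rightarrow> 'w \<Rightarrow> real^'n" and u :: "int \<Rightarrow> 'w \<Rightarrow> real^'p"
    and y :: "int \<Rightarrow> 'w \<Rightarrow> real^'m"
    and z1 :: "int \<Rightarrow> 'w \<Rightarrow> real^'e" and z2 :: "int \<Rightarrow> 'w \<Rightarrow> real^'c"
  assumes "prob_space M"
    and "standing_assumptions S"
    and "noise_model M S \<omega> \<xi> \<zeta>1 \<zeta>2"
    and "\<forall>\<nu>\<in>modes S. \<forall>\<kappa>\<in>modes S. \<forall>k.
           confidence_ellipsoid M (level S) (noise_z2 S \<omega> \<zeta>2 \<nu> \<kappa> t k) (Pb \<nu> \<kappa> k)"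
    and "bij_betw \<tau> UNIV {0..Td S}"
    and "\<mu> \<in> modes S"
    and "\<forall>\<nu>\<in>insert \<mu> (successors S \<mu>). 0 \<le> prior \<nu>"
    and "(\<Sum>\<nu>\<in>insert \<mu> (successors S \<mu>). prior \<nu>) = 1"
    and "pos_def R" and "0 \<le> \<Omega>" and "\<Omega> \<le> 1" and "0 \<le> \<theta>"
    and "\<sigma> t = \<mu>"
    and "\<exists>\<nu>\<in>insert \<mu> (successors S \<mu>). \<forall>s\<in>{t <.. t + int (Td S) - 1}. \<sigma> s = \<nu>"
    and "closed_loop M S \<omega> \<xi> \<zeta>1 \<zeta>2 \<mu> \<sigma> v t xt x u y z1 z2"
    and "(xt, v (t - 1)) \<in> proj_xv0 (O_tilde S Pb \<mu>)"
    and "norm (v (t - 1) - r) \<le> \<theta>"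
    and "is_arg_min (objective S \<tau> prior R \<Omega> r \<mu> xt) (feasible S Pb r \<theta> \<mu> xt) vopt"
    and "\<forall>i < Td S. v (t + int i) = vopt i"
  shows "(\<forall>s\<in>{t .. t + int (Td S) - 1}.
            constraints_hold M (level S) (Z1ext S) (Z2ext S) (z1 s) (z2 s)) \<and>
         ((\<forall>s\<in>{t .. t + int (Td S) - 1}. \<sigma> s = \<mu>) \<longrightarrow>
          (\<forall>s\<in>{t .. t + int (Td S) - 1}.
             constraints_hold M (level S) (Z1 S) (Z2 S) (z1 s) (z2 s)))"
proof -
  have S: "standing_assumptions S" by fact
  have \<mu>: "\<mu> \<in> modes S" by fact
  have succ: "successors S \<mu> \<subseteq> modes S"
    using S \<mu> by (auto simp: standing_assumptions_def)
  have Z: "Z1 S \<subseteq> Z1ext S" "Z2 S \<subseteq> Z2ext S" "Z2ext S \<in> sets borel" "Z2 S \<in> sets borel"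
    using S by (auto simp: standing_assumptions_def intro: borel_compact)
  have feas: "feasible S Pb r \<theta> \<mu> xt vopt"
    using assms by (simp add: is_arg_min_def)
  have bridge: "constraints_hold M (level S) Y1 Y2 (z1 (t + int k)) (z2 (t + int k))"
    if "\<nu> \<in> modes S" "\<forall>s\<in>{t <.. t + int (Td S) - 1}. \<sigma> s = \<nu>" "k < Td S"
      "pred_z1 S \<nu> \<mu> xt vopt k \<in> Y1"
      "pred_z2 S \<nu> \<mu> xt vopt k \<in> pontryagin_diff Y2 (Pb \<nu> \<mu> k)" "Y2 \<in> sets borel"
    for \<nu> k Y1 Y2
    using closed_loop_constraints_hold[OF assms(1-3) _ that(1) assms(15), of k "Pb \<nu> \<mu> k" vopt Y1 Y2]
      assms(4,19) \<mu> that by auto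
  have nominal: "pred_z1 S \<mu> \<mu> xt vopt k \<in> Z1 S"
    "pred_z2 S \<mu> \<mu> xt vopt k \<in> pontryagin_diff (Z2 S) (Pb \<mu> \<mu> k)" if "k < Td S" for k
    using feas that by (auto simp: feasible_def O_tilde_def Phi_bar_def)
  have switched: "pred_z1 S \<nu> \<mu> xt vopt k \<in> Z1ext S"
    "pred_z2 S \<nu> \<mu> xt vopt k \<in> pontryagin_diff (Z2ext S) (Pb \<nu> \<mu> k)"
    if "\<nu> \<in> successors S \<mu>" "k < Td S" for \<nu> k
  proof -
    \<comment> \<open>Holding the last value alters the reference only from step \<open>Td\<close> on, beyond the interval.\<close>
    have "hold_last (Td S) vopt j = vopt j" if "j \<le> k" for j
    proof -
      have "j \<le> Td S - 1" using \<open>j \<le> k\<close> \<open>k < Td S\<close> by linarith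
      then show ?thesis by (simp add: hold_last_def)
    qed
    then have "pred_z1 S \<nu> \<mu> xt (hold_last (Td S) vopt) k = pred_z1 S \<nu> \<mu> xt vopt k"
      "pred_z2 S \<nu> \<mu> xt (hold_last (Td S) vopt) k = pred_z2 S \<nu> \<mu> xt vopt k"
      by (auto simp: pred_z1_def pred_z2_def intro!: arg_cong[where f = "\<lambda>x. _ *v x"] pred_state_cong)
    then show "pred_z1 S \<nu> \<mu> xt vopt k \<in> Z1ext S"
      "pred_z2 S \<nu> \<mu> xt vopt k \<in> pontryagin_diff (Z2ext S) (Pb \<nu> \<mu> k)"
      using feas that unfolding feasible_def by (metis less_imp_le)+
  qed
  have step_of: "\<exists>k<Td S. s = t + int k" if "s \<in> {t .. t + int (Td S) - 1}" for s
    using that by (intro exI[of _ "nat (s - t)"]) auto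
  obtain \<nu> where \<nu>: "\<nu> \<in> insert \<mu> (successors S \<mu>)" "\<forall>s\<in>{t <.. t + int (Td S) - 1}. \<sigma> s = \<nu>"
    using assms(14) by blast
  \<comment> \<open>Without a mode change the prediction meets even the nominal sets, which the relaxed ones contain.\<close>
  have relaxed: "pred_z1 S \<nu> \<mu> xt vopt k \<in> Z1ext S"
    "pred_z2 S \<nu> \<mu> xt vopt k \<in> pontryagin_diff (Z2ext S) (Pb \<nu> \<mu> k)" if "k < Td S" for k
    using \<nu>(1) nominal[OF that] switched[OF _ that] Z(1,2) by (auto simp: pontryagin_diff_def)
  have "\<nu> \<in> modes S" using \<nu>(1) \<mu> succ by blast
  then have "\<forall>s\<in>{t .. t + int (Td S) - 1}.
      constraints_hold M (level S) (Z1ext S) (Z2ext S) (z1 s) (z2 s)"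
    using step_of bridge[OF _ \<nu>(2) _ relaxed Z(3)] by blast
  moreover have "\<forall>s\<in>{t .. t + int (Td S) - 1}.
      constraints_hold M (level S) (Z1 S) (Z2 S) (z1 s) (z2 s)"
    if "\<forall>s\<in>{t .. t + int (Td S) - 1}. \<sigma> s = \<mu>"
  proof -
    have "\<forall>s\<in>{t <.. t + int (Td S) - 1}. \<sigma> s = \<mu>" using that by auto
    then show ?thesis
      using step_of bridge[OF \<mu> _ _ nominal Z(4)] by blast
  qed
  ultimately show ?thesis by blast
qed

end
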